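(* Let $(X,d)$ be an $m$-space, let $K$ be a set (possibly infinite) with at least two elements, let $P=(P_k)_{k\in K}$ be a tuple of nonempty subsets of $X$, and let $T=\mathrm{Dom}$. Let $m$ and $M$ be the least and the greatest (with respect to component-wise inclusion) double zone diagrams with respect to $P$, and let $Y$ be the set of all tuples $(A_k)_{k\in K}$ with $P_k\subseteq A_k\subseteq X$ for all $k\in K$. Then each one of the following six conditions suffices for $X$ to have exactly one zone diagram with respect to $P$: (a) $m=M$; (b) $T^2$ has a unique fixed point; (c) any fixed point of $T^2$ is a fixed point of $T$; (d) the fixed point sets of $T$ and $T^2$ coincide; (e) either $m$ or $M$ is a fixed point of $T$; (f) $A\subseteq B$ for any $A,B\in Y$ which satisfy $T^2(B)\subseteq B$ and $A\subseteq T^2(A)$. If, in addition, $K=\{1,2\}$, then each of these conditions is also necessary for $X$ to have exactly one zone diagram with respect to $P$.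
   Context: An $m$-space is a pair $(X,d)$ of a nonempty set $X$ and a function $d:X^2\to[-\infty,\infty]$ such that $d(x,x)\le d(x,y)$ for all $x,y\in X$ (no symmetry, positivity or triangle inequality is assumed). For $x\in X$ and a nonempty $A\subseteq X$, $d(x,A)=\inf\{d(x,y):y\in A\}$. For nonempty $P,A\subseteq X$, $\mathrm{dom}(P,A)=\{x\in X: d(x,P)\le d(x,A)\}$; it contains $P$, hence is nonempty. Given a tuple $(P_k)_{k\in K}$ of nonempty subsets of $X$, the mapping $\mathrm{Dom}$ from the set of all tuples $(R_k)_{k\in K}$ of nonempty subsets of $X$ to itself is defined by $\mathrm{Dom}(R)=\big(\mathrm{dom}(P_k,\bigcup_{j\ne k}R_j)\big)_{k\in K}$; it maps $Y$ into $Y$. A zone diagram with respect to $P$ is a fixed point of $\mathrm{Dom}$; a double zone diagram with respect to $P$ is a fixed point of $\mathrm{Dom}^2=\mathrm{Dom}\circ\mathrm{Dom}$. Inclusion of tuples is component-wise. Least and greatest double zone diagrams with respect to $P$ (i.e., double zone diagrams $m,M$ with $m\subseteq\mu\subseteq M$ for every double zone diagram $\mu$) always exist. In (e), "either ... or" is inclusive. *)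

theory Defs
  imports "HOL-Library.Extended_Real" "HOL-Library.FuncSet"
begin

definition m_space :: "'a set \<Rightarrow> ('a \<Rightarrow> 'a \<Rightarrow> ereal) \<Rightarrow> bool" where
  "m_space X d \<longleftrightarrow> X \<noteq> {} \<and> (\<forall>x\<in>X. \<forall>y\<in>X. d x x \<le> d x y)"

definition dist_set :: "('a \<Rightarrow> 'a \<Rightarrow> ereal) \<Rightarrow> 'a \<Rightarrow> 'a set \<Rightarrow> ereal" where
  "dist_set d x A = (INF y\<in>A. d x y)"

definition dom_region :: "'a set \<Rightarrow> ('a \<Rightarrow> 'a \<Rightarrow> ereal) \<Rightarrow> 'a set \<Rightarrow> 'a set \<Rightarrow> 'a set" where
  "dom_region X d P A = {x \<in> X. dist_set d x P \<le> dist_set d x A}"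

text \<open>Tuples indexed by \<open>K\<close> are extensional functions (\<open>undefined\<close> outside \<open>K\<close>), so that
  equality of tuples is equality of functions.\<close>

definition tuples :: "'a set \<Rightarrow> 'k set \<Rightarrow> ('k \<Rightarrow> 'a set) set" where
  "tuples X K = (\<Pi>\<^sub>E k\<in>K. {A. A \<noteq> {} \<and> A \<subseteq> X})"

definition tuples_above :: "'a set \<Rightarrow> 'k set \<Rightarrow> ('k \<Rightarrow> 'a set) \<Rightarrow> ('k \<Rightarrow> 'a set) set" where
  "tuples_above X K P = (\<Pi>\<^sub>E k\<in>K. {A. P k \<subseteq> A \<and> A \<subseteq> X})"

definition tuple_le :: "'k set \<Rightarrow> ('k \<Rightarrow> 'a set) \<Rightarrow> ('k \<Rightarrow> 'a set) \<Rightarrow> bool" where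
  "tuple_le K A B \<longleftrightarrow> (\<forall>k\<in>K. A k \<subseteq> B k)"

definition Dom :: "'a set \<Rightarrow> ('a \<Rightarrow> 'a \<Rightarrow> ereal) \<Rightarrow> 'k set \<Rightarrow> ('k \<Rightarrow> 'a set)
    \<Rightarrow> ('k \<Rightarrow> 'a set) \<Rightarrow> ('k \<Rightarrow> 'a set)" where
  "Dom X d K P R = (\<lambda>k\<in>K. dom_region X d (P k) (\<Union>j\<in>K - {k}. R j))"

definition fixed_points :: "'b set \<Rightarrow> ('b \<Rightarrow> 'b) \<Rightarrow> 'b set" where
  "fixed_points S f = {x \<in> S. f x = x}"

definition zone_diagram :: "'a set \<Rightarrow> ('a \<Rightarrow> 'a \<Rightarrow> ereal) \<Rightarrow> 'k set \<Rightarrow> ('k \<Rightarrow> 'a set)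
    \<Rightarrow> ('k \<Rightarrow> 'a set) \<Rightarrow> bool" where
  "zone_diagram X d K P R \<longleftrightarrow> R \<in> fixed_points (tuples X K) (Dom X d K P)"

definition double_zone_diagram :: "'a set \<Rightarrow> ('a \<Rightarrow> 'a \<Rightarrow> ereal) \<Rightarrow> 'k set \<Rightarrow> ('k \<Rightarrow> 'a set)
    \<Rightarrow> ('k \<Rightarrow> 'a set) \<Rightarrow> bool" where
  "double_zone_diagram X d K P R \<longleftrightarrow>
     R \<in> fixed_points (tuples X K) (Dom X d K P \<circ> Dom X d K P)"

definition least_double_zone_diagram :: "'a set \<Rightarrow> ('a \<Rightarrow> 'a \<Rightarrow> ereal) \<Rightarrow> 'k set
    \<Rightarrow> ('k \<Rightarrow> 'a set) \<Rightarrow> ('k \<Rightarrow> 'a set) \<Rightarrow> bool" where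
  "least_double_zone_diagram X d K P m \<longleftrightarrow> double_zone_diagram X d K P m \<and>
     (\<forall>R. double_zone_diagram X d K P R \<longrightarrow> tuple_le K m R)"

definition greatest_double_zone_diagram :: "'a set \<Rightarrow> ('a \<Rightarrow> 'a \<Rightarrow> ereal) \<Rightarrow> 'k set
    \<Rightarrow> ('k \<Rightarrow> 'a set) \<Rightarrow> ('k \<Rightarrow> 'a set) \<Rightarrow> bool" where
  "greatest_double_zone_diagram X d K P M \<longleftrightarrow> double_zone_diagram X d K P M \<and>
     (\<forall>R. double_zone_diagram X d K P R \<longrightarrow> tuple_le K R M)"

lemma tuple_le_trans: "tuple_le K A B \<Longrightarrow> tuple_le K B C \<Longrightarrow> tuple_le K A C"
  unfolding tuple_le_def by blast

lemma tuple_le_antisym: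
  assumes "A \<in> tuples_above X K P" "B \<in> tuples_above X K P" "tuple_le K A B" "tuple_le K B A"
  shows "A = B"
  using assms unfolding tuples_above_def tuple_le_def by (intro PiE_ext) auto

lemma Dom_antimono: "tuple_le K A B \<Longrightarrow> tuple_le K (Dom X d K P B) (Dom X d K P A)"
proof -
  assume le: "tuple_le K A B"
  have "dist_set d x (\<Union>j\<in>K - {k}. B j) \<le> dist_set d x (\<Union>j\<in>K - {k}. A j)" for x k
    using le unfolding dist_set_def tuple_le_def by (intro INF_superset_mono) auto
  then have "dom_region X d Q (\<Union>j\<in>K - {k}. B j) \<subseteq> dom_region X d Q (\<Union>j\<in>K - {k}. A j)" for Q k
    unfolding dom_region_def using order_trans by blast
  then show ?thesis
    by (simp add: tuple_le_def Dom_def)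
qed

lemma Dom_Dom_mono:
  "tuple_le K A B \<Longrightarrow> tuple_le K (Dom X d K P (Dom X d K P A)) (Dom X d K P (Dom X d K P B))"
  by (intro Dom_antimono)

lemma Dom_in_tuples_above:
  assumes "m_space X d" "P \<in> tuples X K" "R \<in> tuples X K"
  shows "Dom X d K P R \<in> tuples_above X K P"
proof -
  have "x \<in> dom_region X d (P k) (\<Union>j\<in>K - {k}. R j)" if k: "k \<in> K" and x: "x \<in> P k" for k x
  proof -
    have X: "x \<in> X" and R: "\<And>j. j \<in> K \<Longrightarrow> R j \<subseteq> X"
      using assms(2,3) k x unfolding tuples_def by (auto simp: PiE_iff)
    have "dist_set d x (P k) \<le> d x x"
      unfolding dist_set_def by (rule INF_lower[OF x])
    also have "d x x \<le> dist_set d x (\<Union>j\<in>K - {k}. R j)"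
      unfolding dist_set_def using assms(1) X R by (intro INF_greatest) (auto simp: m_space_def)
    finally show ?thesis using X by (simp add: dom_region_def)
  qed
  then show ?thesis
    unfolding tuples_above_def Dom_def by (auto simp: PiE_iff dom_region_def)
qed

lemma tuples_above_subset: "P \<in> tuples X K \<Longrightarrow> tuples_above X K P \<subseteq> tuples X K"
  unfolding tuples_above_def tuples_def by (intro PiE_mono) (auto simp: PiE_iff)

lemma double_zone_diagram_iff:
  assumes "m_space X d" "P \<in> tuples X K"
  shows "double_zone_diagram X d K P R \<longleftrightarrow>
    R \<in> tuples_above X K P \<and> Dom X d K P (Dom X d K P R) = R"
proof -
  have Dom: "Dom X d K P A \<in> tuples X K" "Dom X d K P A \<in> tuples_above X K P"
    if "A \<in> tuples X K" for A
    using Dom_in_tuples_above[OF assms that] tuples_above_subset[OF assms(2)] by auto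
  have "R \<in> tuples_above X K P" if "R \<in> tuples X K" "Dom X d K P (Dom X d K P R) = R"
    using Dom(2)[OF Dom(1)[OF that(1)]] that(2) by simp
  then show ?thesis
    using tuples_above_subset[OF assms(2)]
    unfolding double_zone_diagram_def fixed_points_def by auto
qed

lemma ex_least_double_zone_diagram:
  assumes "m_space X d" "P \<in> tuples X K"
  shows "\<exists>m. least_double_zone_diagram X d K P m"
proof -
  let ?S = "\<lambda>R. Dom X d K P (Dom X d K P R)" and ?Y = "tuples_above X K P"
  let ?Q = "{B \<in> ?Y. tuple_le K (?S B) B}"
  define m where "m = (\<lambda>k\<in>K. \<Inter>B\<in>?Q. B k)"
  have S: "?S R \<in> ?Y" if "R \<in> ?Y" for R
    using Dom_in_tuples_above[OF assms] tuples_above_subset[OF assms(2)] that by blast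
  have top: "(\<lambda>k\<in>K. X) \<in> ?Y"
    using assms(2) by (auto simp: tuples_above_def tuples_def PiE_iff)
  have topQ: "(\<lambda>k\<in>K. X) \<in> ?Q"
    using top S[OF top] by (auto simp: tuple_le_def tuples_above_def PiE_iff)
  have le: "tuple_le K m B" if "B \<in> ?Q" for B
    using that unfolding m_def tuple_le_def by auto
  have "P k \<subseteq> m k \<and> m k \<subseteq> X" if "k \<in> K" for k
  proof
    have "P k \<subseteq> B k" if "B \<in> ?Q" for B
      using that \<open>k \<in> K\<close> by (auto simp: tuples_above_def PiE_iff)
    then show "P k \<subseteq> m k"
      using that unfolding m_def by auto
    show "m k \<subseteq> X"
      using le[OF topQ] that by (simp add: tuple_le_def)
  qed
  then have mY: "m \<in> ?Y"
    unfolding tuples_above_def by (intro PiE_I) (auto simp: m_def)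
  have "tuple_le K (?S m) B" if "B \<in> ?Q" for B
    using Dom_Dom_mono[OF le[OF that]] that tuple_le_trans by blast
  then have 1: "tuple_le K (?S m) m"
    by (auto simp: tuple_le_def m_def)
  then have "?S m \<in> ?Q"
    using S[OF mY] Dom_Dom_mono by blast
  then have "?S m = m"
    using tuple_le_antisym[OF S[OF mY] mY 1] le by blast
  moreover have "tuple_le K m R" if "R \<in> ?Y" "?S R = R" for R
    using that by (intro le) (auto simp: tuple_le_def)
  ultimately show ?thesis
    using mY unfolding least_double_zone_diagram_def double_zone_diagram_iff[OF assms] by blast
qed

lemma ex_greatest_double_zone_diagram:
  assumes "m_space X d" "P \<in> tuples X K"
  shows "\<exists>M. greatest_double_zone_diagram X d K P M"
proof -
  let ?S = "\<lambda>R. Dom X d K P (Dom X d K P R)" and ?Y = "tuples_above X K P"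
  let ?Q = "{A \<in> ?Y. tuple_le K A (?S A)}"
  define M where "M = (\<lambda>k\<in>K. \<Union>A\<in>?Q. A k)"
  have S: "?S R \<in> ?Y" if "R \<in> ?Y" for R
    using Dom_in_tuples_above[OF assms] tuples_above_subset[OF assms(2)] that by blast
  have bot: "P \<in> ?Y"
    using assms(2) by (auto simp: tuples_above_def tuples_def PiE_iff)
  have botQ: "P \<in> ?Q"
    using bot S[OF bot] by (auto simp: tuple_le_def tuples_above_def PiE_iff)
  have le: "tuple_le K A M" if "A \<in> ?Q" for A
    using that unfolding M_def tuple_le_def by auto
  have "P k \<subseteq> M k \<and> M k \<subseteq> X" if "k \<in> K" for k
  proof
    have "A k \<subseteq> X" if "A \<in> ?Q" for A
      using that \<open>k \<in> K\<close> by (auto simp: tuples_above_def PiE_iff)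
    then show "M k \<subseteq> X"
      using that unfolding M_def by auto
    show "P k \<subseteq> M k"
      using le[OF botQ] that by (simp add: tuple_le_def)
  qed
  then have MY: "M \<in> ?Y"
    unfolding tuples_above_def by (intro PiE_I) (auto simp: M_def)
  have "tuple_le K A (?S M)" if "A \<in> ?Q" for A
    using Dom_Dom_mono[OF le[OF that]] that tuple_le_trans by blast
  then have 1: "tuple_le K M (?S M)"
    by (auto simp: tuple_le_def M_def)
  then have "?S M \<in> ?Q"
    using S[OF MY] Dom_Dom_mono by blast
  then have "?S M = M"
    using tuple_le_antisym[OF S[OF MY] MY _ 1] le by blast
  moreover have "tuple_le K R M" if "R \<in> ?Y" "?S R = R" for R
    using that by (intro le) (auto simp: tuple_le_def)
  ultimately show ?thesis
    using MY unfolding greatest_double_zone_diagram_def double_zone_diagram_iff[OF assms] by blast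
qed

end

theory Submission
  imports Defs
begin

text \<open>
  Write \<open>T = Dom\<close>. Since \<open>T\<close> is antitone, it permutes the double zone diagrams, reversing their
  order, and therefore swaps the extreme ones: \<open>T m = M\<close> and \<open>T M = m\<close>. Every zone diagram is a double
  zone diagram and so lies between \<open>m\<close> and \<open>M\<close>. If \<open>m = M\<close>, this tuple is thus the only zone diagram,
  and each of the other five conditions forces \<open>m = M\<close>: conditions (b), (c), (d) and (e) make \<open>m\<close>, \<open>M\<close>
  equal or one of them fixed by \<open>T\<close>, and (f) is applied to \<open>A = M\<close>, \<open>B = m\<close>.

  For the converse let \<open>K = {i, j}\<close>. Each component of \<open>T R\<close> depends only on the other component
  of \<open>R\<close>, so the mixed tuples \<open>(m\<^sub>i, M\<^sub>j)\<close> and \<open>(M\<^sub>i, m\<^sub>j)\<close> are both fixed by \<open>T\<close>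
  (lemma \<open>zone_diagram_mix\<close>). If there is just one zone diagram, they agree, which gives \<open>m = M\<close>.
  All six conditions follow from \<open>m = M\<close>; for (f) the Knaster--Tarski theorem shows
  that \<open>A \<subseteq> T\<^sup>2 A\<close> implies \<open>A \<subseteq> M\<close> and that \<open>T\<^sup>2 B \<subseteq> B\<close> implies \<open>m \<subseteq> B\<close>.
\<close>

lemma Dom_in_tuples:
  assumes "m_space X d" "P \<in> tuples X K" "R \<in> tuples X K"
  shows "Dom X d K P R \<in> tuples X K"
  using Dom_in_tuples_above[OF assms] tuples_above_subset[OF assms(2)] by blast

lemma zone_diagram_imp_double:
  "zone_diagram X d K P R \<Longrightarrow> double_zone_diagram X d K P R"
  by (simp add: zone_diagram_def double_zone_diagram_def fixed_points_def)

lemma double_zone_diagram_Dom: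
  assumes "m_space X d" "P \<in> tuples X K" "double_zone_diagram X d K P R"
  shows "double_zone_diagram X d K P (Dom X d K P R)"
  using assms(3) Dom_in_tuples[OF assms(1,2)]
  by (simp add: double_zone_diagram_def fixed_points_def)

lemma double_zone_diagram_antisym:
  assumes "m_space X d" "P \<in> tuples X K"
    and "double_zone_diagram X d K P A" "double_zone_diagram X d K P B"
    and "tuple_le K A B" "tuple_le K B A"
  shows "A = B"
  using assms(3-) unfolding double_zone_diagram_iff[OF assms(1,2)]
  by (blast intro: tuple_le_antisym)

lemma
  assumes "m_space X d" "P \<in> tuples X K"
    and m: "least_double_zone_diagram X d K P m"
    and M: "greatest_double_zone_diagram X d K P M"
  shows Dom_least: "Dom X d K P m = M"
    and Dom_greatest: "Dom X d K P M = m"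
proof -
  let ?T = "Dom X d K P"
  have dm: "double_zone_diagram X d K P m" and dM: "double_zone_diagram X d K P M"
    using m M by (auto simp: least_double_zone_diagram_def greatest_double_zone_diagram_def)
  have TT: "?T (?T m) = m" "?T (?T M) = M"
    using dm dM by (simp_all add: double_zone_diagram_def fixed_points_def)
  have dTm: "double_zone_diagram X d K P (?T m)" and dTM: "double_zone_diagram X d K P (?T M)"
    using dm dM double_zone_diagram_Dom[OF assms(1,2)] by auto
  have "tuple_le K m (?T M)"
    using m dTM by (simp add: least_double_zone_diagram_def)
  from Dom_antimono[OF this, of X d P] have "tuple_le K M (?T m)"
    by (simp add: TT)
  moreover have "tuple_le K (?T m) M"
    using M dTm by (simp add: greatest_double_zone_diagram_def)
  ultimately show "?T m = M"
    using double_zone_diagram_antisym[OF assms(1,2) dTm dM] by blast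
  with TT show "?T M = m" by simp
qed

lemma ex1_zone_diagram_if_least_eq_greatest:
  assumes "m_space X d" "P \<in> tuples X K"
    and m: "least_double_zone_diagram X d K P m"
    and M: "greatest_double_zone_diagram X d K P m"
  shows "\<exists>!R. zone_diagram X d K P R"
proof (rule ex1I)
  show "zone_diagram X d K P m"
    using m Dom_least[OF assms]
    by (simp add: zone_diagram_def least_double_zone_diagram_def double_zone_diagram_def
        fixed_points_def)
next
  fix R assume "zone_diagram X d K P R"
  then have R: "double_zone_diagram X d K P R"
    by (rule zone_diagram_imp_double)
  with m M show "R = m"
    using double_zone_diagram_antisym[OF assms(1,2)]
    unfolding least_double_zone_diagram_def greatest_double_zone_diagram_def by blast
qed

text \<open>
  Outside \<open>K\<close> all values of \<open>Dom\<close> are \<open>undefined\<close>, so \<open>Dom \<circ> Dom\<close> is monotone for the pointwise order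
  on all functions, and the greatest fixed point can be taken in that complete lattice.
\<close>
lemma postfixed_le_greatest:
  assumes "m_space X d" "P \<in> tuples X K"
    and M: "greatest_double_zone_diagram X d K P M"
    and A: "A \<in> tuples_above X K P" and le: "tuple_le K A (Dom X d K P (Dom X d K P A))"
  shows "tuple_le K A M"
proof -
  let ?f = "\<lambda>R. Dom X d K P (Dom X d K P R)"
  have "mono ?f"
  proof (intro monoI le_funI)
    fix R R' :: "'b \<Rightarrow> 'a set" and k
    assume "R \<le> R'"
    then have "tuple_le K (?f R) (?f R')"
      by (intro Dom_Dom_mono) (auto simp: tuple_le_def le_fun_def)
    then show "?f R k \<le> ?f R' k"
      by (cases "k \<in> K") (simp_all add: tuple_le_def, simp add: Dom_def)
  qed
  then have fix_gfp: "?f (gfp ?f) = gfp ?f"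
    by (rule gfp_fixpoint)
  have "A \<le> ?f A"
  proof (rule le_funI)
    fix k show "A k \<le> ?f A k"
      using le A by (cases "k \<in> K") (auto simp: tuple_le_def tuples_above_def PiE_iff
          extensional_def Dom_def)
  qed
  then have "A \<le> gfp ?f"
    by (rule gfp_upperbound)
  then have A_le: "tuple_le K A (gfp ?f)"
    by (simp add: tuple_le_def le_fun_def)
  have "P k \<subseteq> gfp ?f k \<and> gfp ?f k \<subseteq> X" if "k \<in> K" for k
  proof
    show "P k \<subseteq> gfp ?f k"
      using A A_le that unfolding tuples_above_def tuple_le_def by (fastforce simp: PiE_iff)
    have "?f R k \<subseteq> X" for R
      using that by (auto simp: Dom_def dom_region_def)
    then show "gfp ?f k \<subseteq> X"
      by (metis fix_gfp)
  qed
  moreover have "gfp ?f k = undefined" if "k \<notin> K" for k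
    using that fun_cong[OF fix_gfp, of k] by (simp add: Dom_def)
  ultimately have "gfp ?f \<in> tuples_above X K P"
    unfolding tuples_above_def by (intro PiE_I) auto
  with fix_gfp have "double_zone_diagram X d K P (gfp ?f)"
    by (simp add: double_zone_diagram_iff[OF assms(1,2)])
  with M have "tuple_le K (gfp ?f) M"
    by (simp add: greatest_double_zone_diagram_def)
  with A_le show ?thesis
    by (rule tuple_le_trans)
qed

text \<open>
  The dual statement needs no second fixed-point argument: \<open>Dom\<close> turns pre-fixed
  points of \<open>Dom \<circ> Dom\<close> into post-fixed points.
\<close>
lemma least_le_prefixed:
  assumes "m_space X d" "P \<in> tuples X K"
    and m: "least_double_zone_diagram X d K P m"
    and M: "greatest_double_zone_diagram X d K P M"
    and B: "B \<in> tuples_above X K P" and le: "tuple_le K (Dom X d K P (Dom X d K P B)) B"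
  shows "tuple_le K m B"
proof -
  have "Dom X d K P B \<in> tuples_above X K P"
    using B Dom_in_tuples_above[OF assms(1,2)] tuples_above_subset[OF assms(2)] by blast
  then have "tuple_le K (Dom X d K P B) M"
    using postfixed_le_greatest[OF assms(1,2) M] Dom_antimono[OF le] by blast
  then have "tuple_le K (Dom X d K P M) (Dom X d K P (Dom X d K P B))"
    by (rule Dom_antimono)
  with le show ?thesis
    unfolding Dom_greatest[OF assms(1-4)] by (blast intro: tuple_le_trans)
qed

text \<open>
  With only two indices, if \<open>Dom\<close> sends \<open>A\<close> to \<open>B\<close> and \<open>B\<close> back to \<open>A\<close>, replacing one component
  of \<open>A\<close> by that of \<open>B\<close> gives a fixed point of \<open>Dom\<close>.
\<close>
lemma zone_diagram_mix:
  assumes K: "K = {i, j}" "i \<noteq> j"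
    and A: "A \<in> tuples X K" and B: "B \<in> tuples X K"
    and AB: "Dom X d K P A = B" and BA: "Dom X d K P B = A"
  shows "zone_diagram X d K P (A(j := B j))"
proof -
  have diff: "K - {i} = {j}" "K - {j} = {i}"
    using K by auto
  have "dom_region X d (P i) (B j) = A i" "dom_region X d (P j) (A i) = B j"
    using fun_cong[OF BA, of i] fun_cong[OF AB, of j] diff K by (simp_all add: Dom_def)
  moreover have "A k = undefined" if "k \<notin> K" for k
    using A that by (auto simp: tuples_def PiE_iff extensional_def)
  ultimately have "Dom X d K P (A(j := B j)) = A(j := B j)"
    using K diff by (intro ext) (auto simp: Dom_def)
  moreover have "A(j := B j) \<in> tuples X K"
    using A B K by (auto simp: tuples_def PiE_iff extensional_def)
  ultimately show ?thesis
    by (simp add: zone_diagram_def fixed_points_def)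
qed

lemma least_eq_greatest_if_card_2:
  assumes "m_space X d" "P \<in> tuples X K"
    and m: "least_double_zone_diagram X d K P m"
    and M: "greatest_double_zone_diagram X d K P M"
    and "card K = 2" and uniq: "\<exists>!R. zone_diagram X d K P R"
  shows "m = M"
proof -
  obtain i j where K: "K = {i, j}" "i \<noteq> j"
    using \<open>card K = 2\<close> by (auto simp: card_2_iff)
  have mM: "m \<in> tuples X K" "M \<in> tuples X K"
    using m M by (auto simp: least_double_zone_diagram_def greatest_double_zone_diagram_def
        double_zone_diagram_def fixed_points_def)
  note swap = Dom_least[OF assms(1-4)] Dom_greatest[OF assms(1-4)]
  have "zone_diagram X d K P (m(j := M j))" "zone_diagram X d K P (M(j := m j))"
    using zone_diagram_mix[OF K mM swap] zone_diagram_mix[OF K mM(2,1) swap(2,1)] by auto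
  with uniq have eq: "m(j := M j) = M(j := m j)"
    by blast
  have "m i = M i" "m j = M j"
    using fun_cong[OF eq, of i] fun_cong[OF eq, of j] K(2) by simp_all
  then show ?thesis
    using mM K(1) unfolding tuples_def by (intro PiE_ext) auto
qed

theorem corollary6p2:
  fixes X :: "'a set" and d :: "'a \<Rightarrow> 'a \<Rightarrow> ereal" and K :: "'k set"
    and P m M :: "'k \<Rightarrow> 'a set"
    and T :: "('k \<Rightarrow> 'a set) \<Rightarrow> ('k \<Rightarrow> 'a set)" and S Y :: "('k \<Rightarrow> 'a set) set"
  assumes "m_space X d"
    and "\<exists>i\<in>K. \<exists>j\<in>K. i \<noteq> j"
    and "P \<in> tuples X K"
    and "least_double_zone_diagram X d K P m"
    and "greatest_double_zone_diagram X d K P M"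
  defines "T \<equiv> Dom X d K P" and "S \<equiv> tuples X K" and "Y \<equiv> tuples_above X K P"
  shows "(m = M \<longrightarrow> (\<exists>!R. zone_diagram X d K P R)) \<and>
    ((\<exists>!R. R \<in> fixed_points S (T \<circ> T)) \<longrightarrow> (\<exists>!R. zone_diagram X d K P R)) \<and>
    ((\<forall>R \<in> fixed_points S (T \<circ> T). R \<in> fixed_points S T) \<longrightarrow> (\<exists>!R. zone_diagram X d K P R)) \<and>
    (fixed_points S T = fixed_points S (T \<circ> T) \<longrightarrow> (\<exists>!R. zone_diagram X d K P R)) \<and>
    (m \<in> fixed_points S T \<or> M \<in> fixed_points S T \<longrightarrow> (\<exists>!R. zone_diagram X d K P R)) \<and>
    ((\<forall>A\<in>Y. \<forall>B\<in>Y. tuple_le K ((T \<circ> T) B) B \<and> tuple_le K A ((T \<circ> T) A) \<longrightarrow> tuple_le K A B)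
       \<longrightarrow> (\<exists>!R. zone_diagram X d K P R)) \<and>
    (card K = 2 \<longrightarrow> (\<exists>!R. zone_diagram X d K P R) \<longrightarrow>
       m = M \<and>
       (\<exists>!R. R \<in> fixed_points S (T \<circ> T)) \<and>
       (\<forall>R \<in> fixed_points S (T \<circ> T). R \<in> fixed_points S T) \<and>
       fixed_points S T = fixed_points S (T \<circ> T) \<and>
       (m \<in> fixed_points S T \<or> M \<in> fixed_points S T) \<and>
       (\<forall>A\<in>Y. \<forall>B\<in>Y. tuple_le K ((T \<circ> T) B) B \<and> tuple_le K A ((T \<circ> T) A) \<longrightarrow> tuple_le K A B))"
proof -
  note mM = \<open>least_double_zone_diagram X d K P m\<close> \<open>greatest_double_zone_diagram X d K P M\<close>
  note XP = \<open>m_space X d\<close> \<open>P \<in> tuples X K\<close>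
  have dzd: "double_zone_diagram X d K P R \<longleftrightarrow> R \<in> fixed_points S (T \<circ> T)" for R
    by (simp add: double_zone_diagram_def S_def T_def)
  have fp: "m \<in> fixed_points S (T \<circ> T)" "M \<in> fixed_points S (T \<circ> T)"
    and bounds: "\<And>R. R \<in> fixed_points S (T \<circ> T) \<Longrightarrow> tuple_le K m R \<and> tuple_le K R M"
    using mM by (auto simp: least_double_zone_diagram_def greatest_double_zone_diagram_def dzd)
  have swap: "T m = M" "T M = m"
    unfolding T_def using Dom_least[OF XP mM] Dom_greatest[OF XP mM] by auto
  have Y: "m \<in> Y" "M \<in> Y"
    using mM by (auto simp: least_double_zone_diagram_def greatest_double_zone_diagram_def
        double_zone_diagram_iff[OF XP] Y_def)

  have a: "\<exists>!R. zone_diagram X d K P R" if "m = M"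
    using ex1_zone_diagram_if_least_eq_greatest[OF XP mM(1)] mM(2) that by simp
  have b: "m = M" if "\<exists>!R. R \<in> fixed_points S (T \<circ> T)"
    using that fp by blast
  have e: "m = M" if "m \<in> fixed_points S T \<or> M \<in> fixed_points S T"
    using that swap by (auto simp: fixed_points_def)
  have c: "m = M" if "\<forall>R \<in> fixed_points S (T \<circ> T). R \<in> fixed_points S T"
    using that fp e by blast
  have f: "m = M"
    if "\<forall>A\<in>Y. \<forall>B\<in>Y. tuple_le K ((T \<circ> T) B) B \<and> tuple_le K A ((T \<circ> T) A) \<longrightarrow> tuple_le K A B"
  proof -
    have "tuple_le K M m"
      using that Y swap by (simp add: tuple_le_def)
    then show ?thesis
      using Y bounds[OF fp(1)] unfolding Y_def by (blast intro: tuple_le_antisym)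
  qed

  have all: "(\<exists>!R. R \<in> fixed_points S (T \<circ> T)) \<and>
       (\<forall>R \<in> fixed_points S (T \<circ> T). R \<in> fixed_points S T) \<and>
       fixed_points S T = fixed_points S (T \<circ> T) \<and>
       (m \<in> fixed_points S T \<or> M \<in> fixed_points S T) \<and>
       (\<forall>A\<in>Y. \<forall>B\<in>Y. tuple_le K ((T \<circ> T) B) B \<and> tuple_le K A ((T \<circ> T) A) \<longrightarrow> tuple_le K A B)"
    if eq: "m = M"
  proof -
    have only: "R = m" if "R \<in> fixed_points S (T \<circ> T)" for R
      using double_zone_diagram_antisym[OF XP] bounds[OF that] that fp eq dzd by blast
    have T2: "fixed_points S T \<subseteq> fixed_points S (T \<circ> T)"
      by (auto simp: fixed_points_def)
    have mT: "m \<in> fixed_points S T"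
      using fp(1) swap(1) eq by (simp add: fixed_points_def)
    have "tuple_le K A B"
      if "A \<in> Y" "B \<in> Y" "tuple_le K ((T \<circ> T) B) B" "tuple_le K A ((T \<circ> T) A)" for A B
    proof -
      have "tuple_le K A M"
        using that postfixed_le_greatest[OF XP mM(2)] by (simp add: Y_def T_def)
      moreover have "tuple_le K m B"
        using that least_le_prefixed[OF XP mM] by (simp add: Y_def T_def)
      ultimately show ?thesis
        using eq tuple_le_trans by blast
    qed
    moreover have "\<exists>!R. R \<in> fixed_points S (T \<circ> T)"
      using fp(1) only by blast
    moreover have "\<forall>R \<in> fixed_points S (T \<circ> T). R \<in> fixed_points S T"
      using only mT by blast
    ultimately show ?thesis
      using T2 mT by blast
  qed

  show ?thesis
  proof (intro conjI, goal_cases)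
    case 1 show ?case by (intro impI a)
  next
    case 2 show ?case by (rule impI, rule a, rule b)
  next
    case 3 show ?case by (rule impI, rule a, rule c)
  next
    case 4 show ?case by (rule impI, rule a, rule c) simp
  next
    case 5 show ?case by (rule impI, rule a, rule e)
  next
    case 6 show ?case by (rule impI, rule a, rule f)
  next
    case 7
    show ?case
    proof (intro impI)
      assume "card K = 2" "\<exists>!R. zone_diagram X d K P R"
      then have eq: "m = M"
        by (rule least_eq_greatest_if_card_2[OF XP mM])
      show "m = M \<and>
          (\<exists>!R. R \<in> fixed_points S (T \<circ> T)) \<and>
          (\<forall>R \<in> fixed_points S (T \<circ> T). R \<in> fixed_points S T) \<and>
          fixed_points S T = fixed_points S (T \<circ> T) \<and>
          (m \<in> fixed_points S T \<or> M \<in> fixed_points S T) \<and>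
          (\<forall>A\<in>Y. \<forall>B\<in>Y. tuple_le K ((T \<circ> T) B) B \<and> tuple_le K A ((T \<circ> T) A) \<longrightarrow> tuple_le K A B)"
        by (rule conjI[OF eq all[OF eq]])
    qed
  qed
qed

end
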